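(* Let $M=(E,\mathcal I)$ be a matroid with weights $\sigma\in\mathbb R^E_{>0}$ and base family $\mathcal B$. Consider the problem $\operatorname{MKL}_\sigma(\mathcal B)$: $$\text{minimize } -\sum_{e\in E}\sigma(e)\log\eta(e)\quad\text{subject to } \eta=\mathcal N^T\mu,\ \ \eta(e)>0\ \ \forall e\in E,\ \ \mu\in\mathcal P(\mathcal B),$$ over pairs $(\eta,\mu)$. Let $\eta^*$ be the unique optimal $\eta$ for $\operatorname{MKL}_\sigma(\mathcal B)$. Then $\eta^*$ equals the universal density of $M$ with weights $\sigma$.
   Context: All matroids are finite, loopless and of positive rank. $\mathcal N$ is the $|\mathcal B|\times|E|$ matrix whose rows are the indicator vectors of the bases, and $\mathcal P(\mathcal B)$ is the set of probability mass functions on $\mathcal B$, so the vectors $\mathcal N^T\mu$, $\mu\in\mathcal P(\mathcal B)$, form the convex hull $\operatorname{conv}(\mathcal B)\subset\mathbb R^E$ of the indicator vectors of the bases. The universal density of $M$ with weights $\sigma$ is the unique minimizer of $\sum_{e\in E}\sigma(e)^{-1}\eta(e)^2$ over $\eta\in\operatorname{conv}(\mathcal B)$. A minimizer of $\operatorname{MKL}_\sigma(\mathcal B)$ exists, and its $\eta$-component is unique by strict convexity of the objective. *)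

theory Defs
  imports "HOL-Analysis.Analysis" "HOL-Probability.Probability_Mass_Function"
begin

section \<open>Matroids\<close>

definition matroid :: "'a set \<Rightarrow> 'a set set \<Rightarrow> bool" where
  "matroid E \<I> \<longleftrightarrow>
     finite E \<and> \<I> \<subseteq> Pow E \<and> {} \<in> \<I> \<and>
     (\<forall>X\<in>\<I>. \<forall>Y. Y \<subseteq> X \<longrightarrow> Y \<in> \<I>) \<and>
     (\<forall>X\<in>\<I>. \<forall>Y\<in>\<I>. card X < card Y \<longrightarrow> (\<exists>y\<in>Y - X. insert y X \<in> \<I>))"

definition bases :: "'a set set \<Rightarrow> 'a set set" where
  "bases \<I> = {B \<in> \<I>. \<forall>X\<in>\<I>. B \<subseteq> X \<longrightarrow> X = B}"

definition loopless :: "'a set \<Rightarrow> 'a set set \<Rightarrow> bool" where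
  "loopless E \<I> \<longleftrightarrow> (\<forall>e\<in>E. {e} \<in> \<I>)"

definition matroid_rank :: "'a set set \<Rightarrow> nat" where
  "matroid_rank \<I> = Max (card ` \<I>)"

section \<open>The two optimization problems\<close>

text \<open>From here on the ground set is the whole of a finite type \<open>'e\<close>, so that
  \<open>real ^ 'e\<close> is the vector space of real-valued functions on the ground set.\<close>

definition indicator_vec :: "'e set \<Rightarrow> real ^ 'e::finite" where
  "indicator_vec A = (\<chi> e. indicator A e)"

text \<open>The row with index \<open>B\<close> of the matrix \<open>N\<close> is \<open>indicator_vec B\<close>; the next constant is
  the product of the transpose of \<open>N\<close> with the vector of point masses of \<open>\<mu>\<close>.\<close>

definition usage :: "'e set set \<Rightarrow> 'e set pmf \<Rightarrow> real ^ 'e::finite" where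
  "usage \<I> \<mu> = (\<chi> e. \<Sum>B\<in>bases \<I>. indicator_vec B $ e * pmf \<mu> B)"

definition MKL_feasible :: "'e::finite set set \<Rightarrow> (real ^ 'e) \<times> 'e set pmf \<Rightarrow> bool" where
  "MKL_feasible \<I> = (\<lambda>(\<eta>, \<mu>). set_pmf \<mu> \<subseteq> bases \<I> \<and> \<eta> = usage \<I> \<mu> \<and> (\<forall>e. \<eta> $ e > 0))"

definition MKL_objective :: "real ^ 'e \<Rightarrow> (real ^ 'e::finite) \<times> 'e set pmf \<Rightarrow> real" where
  "MKL_objective \<sigma> = (\<lambda>(\<eta>, \<mu>). - (\<Sum>e\<in>UNIV. \<sigma> $ e * ln (\<eta> $ e)))"

definition MKL_minimizer ::
    "'e set set \<Rightarrow> real ^ 'e::finite \<Rightarrow> (real ^ 'e) \<times> 'e set pmf \<Rightarrow> bool" where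
  "MKL_minimizer \<I> \<sigma> = is_arg_min (MKL_objective \<sigma>) (MKL_feasible \<I>)"

definition density_energy :: "real ^ 'e \<Rightarrow> real ^ 'e::finite \<Rightarrow> real" where
  "density_energy \<sigma> \<eta> = (\<Sum>e\<in>UNIV. inverse (\<sigma> $ e) * (\<eta> $ e)\<^sup>2)"

definition base_polytope :: "'e set set \<Rightarrow> (real ^ 'e::finite) set" where
  "base_polytope \<I> = convex hull (indicator_vec ` bases \<I>)"

text \<open>Lemmas \<open>ex1_universal_density\<close> and \<open>ex1_MKL\<close> below show that the two descriptions by
  \<open>THE\<close> are proper.\<close>

definition universal_density :: "'e set set \<Rightarrow> real ^ 'e \<Rightarrow> real ^ 'e::finite" where
  "universal_density \<I> \<sigma> =
     (THE \<eta>. is_arg_min (density_energy \<sigma>) (\<lambda>\<eta>. \<eta> \<in> base_polytope \<I>) \<eta>)"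

definition MKL_density :: "'e set set \<Rightarrow> real ^ 'e \<Rightarrow> real ^ 'e::finite" where
  "MKL_density \<I> \<sigma> = (THE \<eta>. \<exists>\<mu>. MKL_minimizer \<I> \<sigma> (\<eta>, \<mu>))"

section \<open>Well-definedness\<close>

lemma ex_basis_superset:
  fixes \<I> :: "'e::finite set set"
  assumes "X \<in> \<I>"
  obtains B where "B \<in> bases \<I>" "X \<subseteq> B"
proof -
  have "finite {Y\<in>\<I>. X \<subseteq> Y}" "{Y\<in>\<I>. X \<subseteq> Y} \<noteq> {}" using assms by auto
  then obtain B where B: "B \<in> {Y\<in>\<I>. X \<subseteq> Y}"
    and max: "\<forall>Y\<in>{Y\<in>\<I>. X \<subseteq> Y}. B \<subseteq> Y \<longrightarrow> B = Y"
    by (metis (no_types, lifting) finite_has_maximal)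
  have "B \<in> bases \<I>" unfolding bases_def using B max by blast
  then show ?thesis using that B by blast
qed

lemma bases_nonempty:
  fixes \<I> :: "'e::finite set set"
  assumes "matroid UNIV \<I>"
  shows "bases \<I> \<noteq> {}"
  using assms ex_basis_superset[of "{}" \<I>] by (auto simp: matroid_def)

lemma inj_indicator_vec: "inj (indicator_vec :: 'e::finite set \<Rightarrow> real ^ 'e)"
proof (rule injI)
  fix A B :: "'e set" assume "indicator_vec A = (indicator_vec B :: real ^ 'e)"
  then have "indicator A e = (indicator B e :: real)" for e
    by (simp add: indicator_vec_def vec_eq_iff)
  then have "e \<in> A \<longleftrightarrow> e \<in> B" for e by (metis indicator_eq_1_iff)
  then show "A = B" by blast
qed

lemma usage_eq: "usage \<I> \<mu> = (\<Sum>B\<in>bases \<I>. pmf \<mu> B *\<^sub>R indicator_vec B)"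
  by (simp add: usage_def vec_eq_iff mult.commute)

lemma usage_image:
  "usage \<I> ` {\<mu>. set_pmf \<mu> \<subseteq> bases \<I>} = base_polytope \<I>"
proof (intro equalityI subsetI)
  fix \<eta> assume "\<eta> \<in> usage \<I> ` {\<mu>. set_pmf \<mu> \<subseteq> bases \<I>}"
  then obtain \<mu> where \<mu>: "set_pmf \<mu> \<subseteq> bases \<I>" "\<eta> = usage \<I> \<mu>" by blast
  have "sum (pmf \<mu>) (bases \<I>) = 1" using \<mu>(1) by (simp add: sum_pmf_eq_1)
  then show "\<eta> \<in> base_polytope \<I>"
    unfolding \<mu>(2) usage_eq base_polytope_def
    by (intro convex_sum) (auto simp: hull_inc)
next
  fix \<eta> assume "\<eta> \<in> base_polytope \<I>"
  then obtain u where u: "\<forall>x\<in>indicator_vec ` bases \<I>. 0 \<le> u x"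
    "sum u (indicator_vec ` bases \<I>) = 1"
    "(\<Sum>x\<in>indicator_vec ` bases \<I>. u x *\<^sub>R x) = \<eta>"
    unfolding base_polytope_def by (auto simp: convex_hull_finite)
  have inj: "inj_on indicator_vec (bases \<I>)"
    using inj_indicator_vec by (rule inj_on_subset) simp
  define w where "w = (\<lambda>B. if B \<in> bases \<I> then u (indicator_vec B) else 0)"
  have nn: "0 \<le> w B" for B using u(1) by (simp add: w_def)
  have s: "sum w UNIV = 1"
    using u(2) by (simp add: w_def sum.reindex[OF inj] sum.If_cases)
  have one: "(\<integral>\<^sup>+ B. ennreal (w B) \<partial>count_space UNIV) = 1"
    using nn s by (simp add: nn_integral_count_space_finite)
  define \<mu> where "\<mu> = embed_pmf w"
  have p: "pmf \<mu> B = w B" for B unfolding \<mu>_def by (rule pmf_embed_pmf[OF nn one])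
  have "set_pmf \<mu> \<subseteq> bases \<I>"
    by (auto simp: set_pmf_iff p w_def split: if_splits)
  moreover have "usage \<I> \<mu> = \<eta>"
    using u(3) by (simp add: usage_eq p w_def sum.reindex[OF inj])
  ultimately show "\<eta> \<in> usage \<I> ` {\<mu>. set_pmf \<mu> \<subseteq> bases \<I>}" by blast
qed

lemma compact_base_polytope: "compact (base_polytope \<I>)"
  unfolding base_polytope_def by (intro finite_imp_compact_convex_hull) simp

lemma convex_base_polytope: "convex (base_polytope \<I>)"
  by (simp add: base_polytope_def)

lemma base_polytope_le_1:
  assumes "\<eta> \<in> base_polytope \<I>"
  shows "\<eta> $ e \<le> 1"
proof -
  have "base_polytope \<I> \<subseteq> {\<eta>. \<eta> $ e \<le> 1}"
    unfolding base_polytope_def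
  proof (rule hull_minimal)
    show "convex {\<eta> :: real ^ 'a. \<eta> $ e \<le> 1}"
      using convex_halfspace_le[of "axis e (1::real)" 1] by (simp add: inner_axis' )
  qed (auto simp: indicator_vec_def indicator_def)
  then show ?thesis using assms by blast
qed

lemma is_arg_min_midpoint_unique:
  fixes f :: "'v::real_vector \<Rightarrow> real"
  assumes "is_arg_min f P x" "is_arg_min f P y"
    and "P ((1/2) *\<^sub>R (x + y))"
    and "x \<noteq> y \<Longrightarrow> f ((1/2) *\<^sub>R (x + y)) < (f x + f y) / 2"
  shows "x = y"
  using assms unfolding is_arg_min_linorder by fastforce

lemma sum_strict_ex:
  fixes f g :: "'e::finite \<Rightarrow> real"
  assumes "\<And>e. f e \<le> g e" "f e < g e"
  shows "sum f UNIV < sum g UNIV"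
  using assms by (intro sum_strict_mono_ex1) auto

lemma ex1_universal_density:
  fixes \<sigma> :: "real ^ 'e::finite"
  assumes "matroid UNIV \<I>" and pos: "\<And>e. \<sigma> $ e > 0"
  shows "\<exists>!\<eta>. is_arg_min (density_energy \<sigma>) (\<lambda>\<eta>. \<eta> \<in> base_polytope \<I>) \<eta>"
proof -
  have "base_polytope \<I> \<noteq> {}"
    using bases_nonempty[OF assms(1)] by (simp add: base_polytope_def)
  moreover have "continuous_on (base_polytope \<I>) (density_energy \<sigma>)"
    unfolding density_energy_def by (intro continuous_intros)
  ultimately obtain \<eta> where "\<eta> \<in> base_polytope \<I>"
    "\<forall>y\<in>base_polytope \<I>. density_energy \<sigma> \<eta> \<le> density_energy \<sigma> y"
    using continuous_attains_inf[OF compact_base_polytope] by blast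
  then have "is_arg_min (density_energy \<sigma>) (\<lambda>\<eta>. \<eta> \<in> base_polytope \<I>) \<eta>"
    by (simp add: is_arg_min_linorder)
  moreover have "x = y"
    if x: "is_arg_min (density_energy \<sigma>) (\<lambda>\<eta>. \<eta> \<in> base_polytope \<I>) x"
      and y: "is_arg_min (density_energy \<sigma>) (\<lambda>\<eta>. \<eta> \<in> base_polytope \<I>) y" for x y
  proof (rule is_arg_min_midpoint_unique[OF x y])
    have "x \<in> base_polytope \<I>" "y \<in> base_polytope \<I>"
      using x y by (auto simp: is_arg_min_def)
    then show "(1/2) *\<^sub>R (x + y) \<in> base_polytope \<I>"
      using convexD[OF convex_base_polytope, of x \<I> y "1/2" "1/2"]
      by (simp add: scaleR_right_distrib)
  next
    assume "x \<noteq> y"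
    then obtain e where e: "x $ e \<noteq> y $ e" by (auto simp: vec_eq_iff)
    have eq: "inverse s * ((1/2) * (a + b))\<^sup>2 + inverse s * ((a - b) / 2)\<^sup>2
        = (inverse s * a\<^sup>2 + inverse s * b\<^sup>2) / 2" for s a b :: real
      by (simp add: power2_eq_square algebra_simps add_divide_distrib diff_divide_distrib)
    have ge: "0 \<le> inverse (\<sigma> $ i) * ((x $ i - y $ i) / 2)\<^sup>2" for i
      using pos[of i] by simp
    have gt: "0 < inverse (\<sigma> $ e) * ((x $ e - y $ e) / 2)\<^sup>2"
      using pos[of e] e by simp
    have "density_energy \<sigma> ((1/2) *\<^sub>R (x + y))
        < (\<Sum>i\<in>UNIV. (inverse (\<sigma> $ i) * (x $ i)\<^sup>2 + inverse (\<sigma> $ i) * (y $ i)\<^sup>2) / 2)"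
      unfolding density_energy_def
      by (rule sum_strict_ex[where e = e], use eq ge gt in \<open>simp_all flip: eq\<close>)
    also have "\<dots> = (density_energy \<sigma> x + density_energy \<sigma> y) / 2"
      by (simp add: density_energy_def sum.distrib flip: sum_divide_distrib)
    finally show "density_energy \<sigma> ((1/2) *\<^sub>R (x + y))
        < (density_energy \<sigma> x + density_energy \<sigma> y) / 2" .
  qed
  ultimately show ?thesis by blast
qed

lemma ex_positive_point:
  fixes \<I> :: "'e::finite set set"
  assumes "matroid UNIV \<I>" "loopless UNIV \<I>"
  obtains \<eta> where "\<eta> \<in> base_polytope \<I>" "\<And>e. \<eta> $ e > 0"
proof -
  let ?n = "real (card (bases \<I>))"
  have n: "?n > 0" using bases_nonempty[OF assms(1)] by (simp add: card_gt_0_iff)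
  define \<eta> :: "real ^ 'e" where "\<eta> = (\<Sum>B\<in>bases \<I>. (1 / ?n) *\<^sub>R indicator_vec B)"
  have "\<eta> \<in> base_polytope \<I>"
    unfolding \<eta>_def base_polytope_def using n
    by (intro convex_sum) (auto simp: hull_inc)
  moreover have "\<eta> $ e > 0" for e
  proof -
    have "{e} \<in> \<I>" using assms(2) by (simp add: loopless_def)
    then obtain B where B: "B \<in> bases \<I>" "e \<in> B" using ex_basis_superset by blast
    have "0 < (\<Sum>B\<in>bases \<I>. (1 / ?n) * (indicator B e :: real))"
      using n B by (intro sum_pos2[of _ B]) auto
    then show ?thesis by (simp add: \<eta>_def indicator_vec_def)
  qed
  ultimately show ?thesis using that by blast
qed

lemma ln_midpoint:
  fixes a b :: real
  assumes "a > 0" "b > 0"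
  shows "(ln a + ln b) / 2 \<le> ln ((a + b) / 2)"
    and "a \<noteq> b \<Longrightarrow> (ln a + ln b) / 2 < ln ((a + b) / 2)"
proof -
  have eq: "(ln a + ln b) / 2 = ln (sqrt (a * b))"
    using assms by (simp add: ln_sqrt ln_mult)
  show "(ln a + ln b) / 2 \<le> ln ((a + b) / 2)"
    unfolding eq using assms arith_geo_mean_sqrt[of a b] by simp
  assume "a \<noteq> b"
  then have "a * b < ((a + b) / 2)\<^sup>2"
    using zero_less_power2[of "a - b"] by (simp add: power2_eq_square field_simps)
  then have "sqrt (a * b) < (a + b) / 2" using assms by (intro real_less_lsqrt) auto
  then show "(ln a + ln b) / 2 < ln ((a + b) / 2)" unfolding eq using assms by simp
qed

lemma MKL_minimizer_iff:
  "(\<exists>\<mu>. MKL_minimizer \<I> \<sigma> (\<eta>, \<mu>)) \<longleftrightarrow>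
     is_arg_min (\<lambda>\<eta>. - (\<Sum>e\<in>UNIV. \<sigma> $ e * ln (\<eta> $ e)))
       (\<lambda>\<eta>. \<eta> \<in> base_polytope \<I> \<and> (\<forall>e. \<eta> $ e > 0)) \<eta>"
  unfolding MKL_minimizer_def is_arg_min_def MKL_feasible_def MKL_objective_def
    usage_image[symmetric]
  by auto

lemma ex1_MKL:
  fixes \<sigma> :: "real ^ 'e::finite"
  assumes M: "matroid UNIV \<I>" "loopless UNIV \<I>" and pos: "\<And>e. \<sigma> $ e > 0"
  shows "\<exists>!\<eta>. \<exists>\<mu>. MKL_minimizer \<I> \<sigma> (\<eta>, \<mu>)"
proof -
  define f where "f = (\<lambda>\<eta>::real^'e. - (\<Sum>e\<in>UNIV. \<sigma> $ e * ln (\<eta> $ e)))"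
  define P where "P = (\<lambda>\<eta>::real^'e. \<eta> \<in> base_polytope \<I> \<and> (\<forall>e. \<eta> $ e > 0))"
  obtain \<eta>0 where \<eta>0: "\<eta>0 \<in> base_polytope \<I>" "\<And>e. \<eta>0 $ e > 0"
    using ex_positive_point[OF M] by blast
  define \<delta> where "\<delta> = (\<lambda>e. exp (- f \<eta>0 / \<sigma> $ e))"
  define K where "K = base_polytope \<I> \<inter> {\<eta>. \<forall>e. \<delta> e \<le> \<eta> $ e}"
  have low: "\<eta> \<in> K" if \<eta>: "P \<eta>" "f \<eta> \<le> f \<eta>0" for \<eta>
  proof -
    have "\<delta> e \<le> \<eta> $ e" for e
    proof -
      have le: "ln (\<eta> $ i) \<le> 0" for i
        using \<eta>(1) base_polytope_le_1[of \<eta> \<I> i] by (auto simp: P_def)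
      have nn: "0 \<le> - (\<sigma> $ i * ln (\<eta> $ i))" for i
        using pos[of i] le[of i] by (simp add: mult_nonneg_nonpos)
      have "- (\<sigma> $ e * ln (\<eta> $ e)) \<le> f \<eta>"
        unfolding f_def sum_negf[symmetric] by (rule member_le_sum) (use nn in auto)
      then have "- f \<eta>0 \<le> \<sigma> $ e * ln (\<eta> $ e)" using \<eta>(2) by simp
      then have "- f \<eta>0 / \<sigma> $ e \<le> ln (\<eta> $ e)"
        using pos[of e] by (simp add: field_simps)
      then have "\<delta> e \<le> exp (ln (\<eta> $ e))" unfolding \<delta>_def by (simp only: exp_le_cancel_iff)
      then show ?thesis using \<eta>(1) by (simp add: P_def)
    qed
    then show ?thesis using \<eta>(1) by (simp add: K_def P_def)
  qed
  have KP: "P \<eta>" if "\<eta> \<in> K" for \<eta>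
    using that by (auto simp: K_def P_def \<delta>_def intro: less_le_trans[OF exp_gt_zero])
  have "closed {\<eta>::real^'e. \<forall>e. \<delta> e \<le> \<eta> $ e}"
    by (intro closed_Collect_all closed_Collect_le continuous_intros)
  then have "compact K" unfolding K_def by (intro compact_Int_closed compact_base_polytope)
  moreover have K0: "\<eta>0 \<in> K" using \<eta>0 by (intro low) (auto simp: P_def)
  moreover have "continuous_on K f"
    unfolding f_def using KP by (intro continuous_intros) (auto simp: P_def less_le)
  ultimately obtain \<eta> where \<eta>: "\<eta> \<in> K" "\<And>y. y \<in> K \<Longrightarrow> f \<eta> \<le> f y"
    using continuous_attains_inf[of K f] by blast
  have "f \<eta> \<le> f y" if "P y" for y
    using \<eta>(2)[of y] \<eta>(2)[OF K0] low[OF that] by linarith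
  then have "is_arg_min f P \<eta>" using KP[OF \<eta>(1)] by (simp add: is_arg_min_linorder)
  moreover have "x = y" if x: "is_arg_min f P x" and y: "is_arg_min f P y" for x y
  proof (rule is_arg_min_midpoint_unique[OF x y])
    have xy: "x \<in> base_polytope \<I>" "y \<in> base_polytope \<I>" "\<And>e. x $ e > 0" "\<And>e. y $ e > 0"
      using x y by (auto simp: is_arg_min_def P_def)
    then show "P ((1/2) *\<^sub>R (x + y))"
      using convexD[OF convex_base_polytope, of x \<I> y "1/2" "1/2"]
      by (simp add: P_def scaleR_right_distrib add_pos_pos)
    assume "x \<noteq> y"
    then obtain e where e: "x $ e \<noteq> y $ e" by (auto simp: vec_eq_iff)
    have "(\<Sum>i\<in>UNIV. \<sigma> $ i * ((ln (x $ i) + ln (y $ i)) / 2))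
        < (\<Sum>i\<in>UNIV. \<sigma> $ i * ln ((x $ i + y $ i) / 2))"
    proof (rule sum_strict_ex[where e = e])
      show "\<sigma> $ i * ((ln (x $ i) + ln (y $ i)) / 2) \<le> \<sigma> $ i * ln ((x $ i + y $ i) / 2)" for i
        using ln_midpoint(1)[OF xy(3,4), of i i] pos[of i] by (intro mult_left_mono) auto
      show "\<sigma> $ e * ((ln (x $ e) + ln (y $ e)) / 2) < \<sigma> $ e * ln ((x $ e + y $ e) / 2)"
        using ln_midpoint(2)[OF xy(3,4) e] pos[of e] by (intro mult_strict_left_mono) auto
    qed
    moreover have "(\<Sum>i\<in>UNIV. \<sigma> $ i * ((ln (x $ i) + ln (y $ i)) / 2)) = - (f x + f y) / 2"
      by (simp add: f_def distrib_left sum.distrib add_divide_distrib flip: sum_divide_distrib)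
    moreover have "(\<Sum>i\<in>UNIV. \<sigma> $ i * ln ((x $ i + y $ i) / 2)) = - f ((1/2) *\<^sub>R (x + y))"
      by (simp add: f_def)
    ultimately show "f ((1/2) *\<^sub>R (x + y)) < (f x + f y) / 2" by linarith
  qed
  ultimately show ?thesis
    unfolding MKL_minimizer_iff f_def[symmetric] P_def[symmetric] by blast
qed

end

theory Submission
  imports Defs
begin

text \<open>
  Both problems ask for a point of the base polytope that is extremal for a linear functional
  determined by the point itself. First-order optimality of \<open>\<eta>\<close> in the logarithmic problem says
  that \<open>\<eta>\<close> maximizes \<open>x \<mapsto> \<Sum>e. w e * x e\<close> over the polytope, where \<open>w e = \<sigma> e / \<eta> e\<close>, and
  optimality of \<open>\<eta>\<close> for the energy says that \<open>\<eta>\<close> minimizes \<open>x \<mapsto> \<Sum>e. c e * x e\<close>, where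
  \<open>c e = \<eta> e / \<sigma> e\<close>. These weights are reciprocal: \<open>c = 1 / w\<close>.

  For a general polytope neither condition implies the other. In a matroid, however, which bases have
  maximum weight depends only on the order in which the weights arrange the ground set (the greedy
  principle), and passing from \<open>w\<close> to \<open>1 / w\<close> reverses this order. Hence a basis of maximum
  \<open>w\<close>-weight has minimum \<open>c\<close>-weight (\<open>max_basis_is_min_basis\<close>). As \<open>\<eta>\<close> is a convex combination of
  bases of maximum \<open>w\<close>-weight, it minimizes \<open>c\<close> over the polytope (\<open>maximizer_is_minimizer\<close>), and
  convexity of the energy makes this necessary condition sufficient. The argument starts from the
  logarithmic problem because there positivity of \<open>\<eta>\<close>, without which \<open>w\<close> is meaningless,
  is part of feasibility.
\<close>

section \<open>Exchange between independent sets\<close>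

lemma matroid_subset: "matroid E \<I> \<Longrightarrow> X \<in> \<I> \<Longrightarrow> Y \<subseteq> X \<Longrightarrow> Y \<in> \<I>"
  unfolding matroid_def by blast

lemma matroid_augment:
  assumes "matroid E \<I>" "X \<in> \<I>" "Y \<in> \<I>" "card X < card Y"
  obtains y where "y \<in> Y" "y \<notin> X" "insert y X \<in> \<I>"
proof -
  have "\<forall>X\<in>\<I>. \<forall>Y\<in>\<I>. card X < card Y \<longrightarrow> (\<exists>y\<in>Y - X. insert y X \<in> \<I>)"
    using assms(1) unfolding matroid_def by (elim conjE)
  then show thesis using assms(2-4) that by blast
qed

lemma augment_to_card:
  fixes \<I> :: "'e::finite set set"
  assumes M: "matroid UNIV \<I>" and "X \<in> \<I>" "Y \<in> \<I>" "card X \<le> card Y"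
  obtains Z where "Z \<in> \<I>" "X \<subseteq> Z" "Z \<subseteq> X \<union> Y" "card Z = card Y"
proof -
  have "\<exists>Z\<in>\<I>. X \<subseteq> Z \<and> Z \<subseteq> X \<union> Y \<and> card Z = card Y"
    using assms(2,4)
  proof (induction "card Y - card X" arbitrary: X)
    case 0
    then show ?case by (intro bexI[of _ X]) auto
  next
    case (Suc n)
    then have "card X < card Y" by simp
    then obtain y where y: "y \<in> Y" "y \<notin> X" "insert y X \<in> \<I>"
      using matroid_augment[OF M \<open>X \<in> \<I>\<close> \<open>Y \<in> \<I>\<close>] by blast
    then have "card (insert y X) = Suc (card X)" by simp
    then have "\<exists>Z\<in>\<I>. insert y X \<subseteq> Z \<and> Z \<subseteq> insert y X \<union> Y \<and> card Z = card Y"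
      using Suc.hyps(2) \<open>card X < card Y\<close> y(3) by (intro Suc.hyps(1)) simp_all
    then show ?case using y(1) by blast
  qed
  then show thesis using that by blast
qed

lemma independent_card_le_basis:
  fixes \<I> :: "'e::finite set set"
  assumes M: "matroid UNIV \<I>" and "B \<in> bases \<I>" "X \<in> \<I>"
  shows "card X \<le> card B"
proof (rule ccontr)
  assume "\<not> card X \<le> card B"
  moreover have "B \<in> \<I>" using assms(2) by (simp add: bases_def)
  ultimately obtain y where "y \<notin> B" "insert y B \<in> \<I>"
    using matroid_augment[OF M _ assms(3)] by (auto simp: not_le)
  then show False using assms(2) by (auto simp: bases_def)
qed

lemma basis_iff_card:
  fixes \<I> :: "'e::finite set set"
  assumes M: "matroid UNIV \<I>" and B: "B \<in> bases \<I>"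
  shows "X \<in> bases \<I> \<longleftrightarrow> X \<in> \<I> \<and> card X = card B"
proof
  assume "X \<in> bases \<I>"
  moreover have "X \<in> \<I>" "B \<in> \<I>" using \<open>X \<in> bases \<I>\<close> B by (simp_all add: bases_def)
  ultimately show "X \<in> \<I> \<and> card X = card B"
    using independent_card_le_basis[OF M] B by (simp add: antisym)
next
  assume X: "X \<in> \<I> \<and> card X = card B"
  then obtain C where C: "C \<in> bases \<I>" "X \<subseteq> C" using ex_basis_superset by blast
  then have "C \<in> \<I>" by (simp add: bases_def)
  then have "card C \<le> card X" using X independent_card_le_basis[OF M B] by simp
  then have "X = C" using C(2) by (intro card_seteq) simp_all
  then show "X \<in> bases \<I>" using C(1) by simp
qed

section \<open>Bases of extremal weight\<close>

text \<open>
  If \<open>B\<close> were beaten inside \<open>W\<close>, then \<open>B \<inter> W\<close> could be augmented by some \<open>y\<close> in \<open>W - B\<close>, and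
  completing the result by elements of \<open>B\<close> would trade an element of \<open>B\<close> outside \<open>W\<close> for the
  heavier \<open>y\<close>.
\<close>

lemma max_basis_dominates_on_upper_set:
  fixes \<I> :: "'e::finite set set" and w :: "'e \<Rightarrow> real"
  assumes M: "matroid UNIV \<I>" and B: "B \<in> bases \<I>" and C: "C \<in> bases \<I>"
    and max: "\<And>A. A \<in> bases \<I> \<Longrightarrow> sum w A \<le> sum w B"
    and upper: "\<And>y z. y \<in> W \<Longrightarrow> z \<notin> W \<Longrightarrow> w z < w y"
  shows "card (C \<inter> W) \<le> card (B \<inter> W)"
proof (rule ccontr)
  assume "\<not> card (C \<inter> W) \<le> card (B \<inter> W)"
  moreover have "B \<inter> W \<in> \<I>" "C \<inter> W \<in> \<I>"
    using B C by (auto simp: bases_def intro: matroid_subset[OF M])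
  ultimately obtain y where y: "y \<in> W" "y \<notin> B" "insert y (B \<inter> W) \<in> \<I>"
    using matroid_augment[OF M, of "B \<inter> W" "C \<inter> W"] by (auto simp: not_le)
  have "B \<in> \<I>" using B by (simp add: bases_def)
  then obtain A where A: "A \<in> \<I>" "insert y (B \<inter> W) \<subseteq> A" "A \<subseteq> insert y (B \<inter> W) \<union> B"
      "card A = card B"
    using augment_to_card[OF M y(3)] independent_card_le_basis[OF M B y(3)] by blast
  then have "A \<in> bases \<I>" using basis_iff_card[OF M B] by blast
  have sub: "A \<subseteq> insert y B" using A(3) by blast
  have "card (insert y B - A) = 1"
    using A(4) y(2) card_Diff_subset[OF _ sub] by simp
  then obtain z where z: "insert y B - A = {z}" by (auto simp: card_1_singleton_iff)
  then have "z \<notin> W" using A(2) by blast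
  have "insert y B = insert z A" "z \<notin> A" using z sub by blast+
  then have "w y + sum w B = w z + sum w A" using y(2) by (metis finite sum.insert)
  then show False using max[OF \<open>A \<in> bases \<I>\<close>] upper[OF y(1) \<open>z \<notin> W\<close>] by linarith
qed

text \<open>
  Matching the largest value on \<open>A\<close> with some value on \<open>B\<close> that is at least as large, and deleting
  both, preserves the hypothesis: below that value both counts drop by one, and above it the count
  for \<open>A\<close> is zero.
\<close>

lemma sum_le_of_upper_level_counts:
  fixes c :: "'e \<Rightarrow> real"
  assumes "finite A" "finite B" "card A = card B"
    and "\<And>s. card {a \<in> A. s \<le> c a} \<le> card {b \<in> B. s \<le> c b}"
  shows "sum c A \<le> sum c B"
  using assms
proof (induction "card A" arbitrary: A B)
  case 0
  then show ?case by simp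
next
  case (Suc n)
  then have "A \<noteq> {}" by auto
  then have "Max (c ` A) \<in> c ` A" using Suc.prems(1) by (intro Max_in) auto
  then obtain a where a: "a \<in> A" "Max (c ` A) = c a" by auto
  then have amax: "c x \<le> c a" if "x \<in> A" for x
    using that Suc.prems(1) unfolding a(2)[symmetric] by (intro Max_ge) auto
  have "0 < card {x \<in> A. c a \<le> c x}" using a(1) Suc.prems(1) by (auto simp: card_gt_0_iff)
  then have "0 < card {x \<in> B. c a \<le> c x}" using Suc.prems(4) by (rule less_le_trans)
  then obtain b where b: "b \<in> B" "c a \<le> c b" by (auto simp: card_gt_0_iff)
  have "sum c (A - {a}) \<le> sum c (B - {b})"
  proof (rule Suc.hyps(1))
    show "n = card (A - {a})" "finite (A - {a})" "finite (B - {b})"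
      "card (A - {a}) = card (B - {b})"
      using Suc.hyps(2) Suc.prems a b by (auto simp: card_Diff_singleton)
    fix s
    show "card {x \<in> A - {a}. s \<le> c x} \<le> card {x \<in> B - {b}. s \<le> c x}"
    proof (cases "s \<le> c a")
      case True
      have "{x \<in> A - {a}. s \<le> c x} = {x \<in> A. s \<le> c x} - {a}"
        "{x \<in> B - {b}. s \<le> c x} = {x \<in> B. s \<le> c x} - {b}" by auto
      then show ?thesis
        using Suc.prems(4)[of s] True a b by (simp add: card_Diff_singleton)
    next
      case False
      then have "\<not> s \<le> c x" if "x \<in> A" for x using amax[OF that] by linarith
      then have "{x \<in> A - {a}. s \<le> c x} = {}" by blast
      then show ?thesis by (simp only: card.empty zero_le)
    qed
  qed
  then show ?case using a b Suc.prems(1,2) by (simp add: sum.remove)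
qed

text \<open>
  The greedy principle: the complement of an upper level set of \<open>c\<close> is an upper set for \<open>w\<close>, so a
  \<open>w\<close>-maximal basis meets every upper level set of \<open>c\<close> in as few elements as any basis can.
\<close>

lemma max_basis_is_min_basis:
  fixes \<I> :: "'e::finite set set" and w c :: "'e \<Rightarrow> real"
  assumes M: "matroid UNIV \<I>" and B: "B \<in> bases \<I>" and C: "C \<in> bases \<I>"
    and max: "\<And>A. A \<in> bases \<I> \<Longrightarrow> sum w A \<le> sum w B"
    and rev: "\<And>y z. c y < c z \<Longrightarrow> w z < w y"
  shows "sum c B \<le> sum c C"
proof (rule sum_le_of_upper_level_counts)
  show eq: "card B = card C" using basis_iff_card[OF M B] C by simp
  fix s
  have split: "card {x \<in> A. s \<le> c x} = card A - card (A \<inter> {x. c x < s})" for A :: "'e set"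
  proof -
    have "{x \<in> A. s \<le> c x} = A - A \<inter> {x. c x < s}" by auto
    then show ?thesis by (simp add: card_Diff_subset)
  qed
  have "card (C \<inter> {x. c x < s}) \<le> card (B \<inter> {x. c x < s})"
    by (rule max_basis_dominates_on_upper_set[OF M B C max]) (auto intro: rev)
  then show "card {x \<in> B. s \<le> c x} \<le> card {x \<in> C. s \<le> c x}"
    by (simp add: split eq)
qed simp_all

section \<open>Extremal points of the base polytope\<close>

lemma inner_indicator_vec: "w \<bullet> indicator_vec B = (\<Sum>e\<in>B. w $ e)"
proof -
  have "w \<bullet> indicator_vec B = (\<Sum>e\<in>UNIV. w $ e * indicator B e)"
    by (simp add: inner_vec_def indicator_vec_def)
  also have "\<dots> = (\<Sum>e\<in>B. w $ e)"
    by (subst sum_mult_indicator) simp_all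
  finally show ?thesis .
qed

lemma inner_base_polytope_ge:
  assumes "\<And>B. B \<in> bases \<I> \<Longrightarrow> m \<le> c \<bullet> indicator_vec B" and "x \<in> base_polytope \<I>"
  shows "m \<le> c \<bullet> x"
proof -
  have "base_polytope \<I> \<subseteq> {x. m \<le> c \<bullet> x}"
    unfolding base_polytope_def using assms(1)
    by (intro hull_minimal) (auto simp: convex_halfspace_ge)
  then show ?thesis using assms(2) by blast
qed

lemma base_polytope_nonneg:
  assumes "x \<in> base_polytope \<I>"
  shows "0 \<le> x $ e"
  using inner_base_polytope_ge[OF _ assms, of 0 "axis e 1"]
  by (simp add: inner_axis' indicator_vec_def)

text \<open>
  By complementary slackness, all bases in a convex combination representing \<open>\<eta>\<close> attain the
  maximum of \<open>w\<close>; each of them attains the minimum of \<open>c\<close>, and so does their mean \<open>\<eta>\<close>.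
\<close>

lemma maximizer_is_minimizer:
  fixes \<I> :: "'e::finite set set" and w c :: "real ^ 'e"
  assumes M: "matroid UNIV \<I>" and \<eta>: "\<eta> \<in> base_polytope \<I>" and x: "x \<in> base_polytope \<I>"
    and max: "\<And>B. B \<in> bases \<I> \<Longrightarrow> w \<bullet> indicator_vec B \<le> w \<bullet> \<eta>"
    and rev: "\<And>y z. c $ y < c $ z \<Longrightarrow> w $ z < w $ y"
  shows "c \<bullet> \<eta> \<le> c \<bullet> x"
proof (rule inner_base_polytope_ge[OF _ x])
  fix C assume C: "C \<in> bases \<I>"
  obtain \<mu> where \<mu>: "set_pmf \<mu> \<subseteq> bases \<I>" "\<eta> = usage \<I> \<mu>"
    using \<eta> by (auto simp flip: usage_image)
  have total: "sum (pmf \<mu>) (bases \<I>) = 1" using \<mu>(1) by (simp add: sum_pmf_eq_1)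
  have mean: "v \<bullet> \<eta> = (\<Sum>B\<in>bases \<I>. pmf \<mu> B * (v \<bullet> indicator_vec B))" for v
    by (simp add: \<mu>(2) usage_eq inner_sum_right)
  have "(\<Sum>B\<in>bases \<I>. pmf \<mu> B * (w \<bullet> \<eta> - w \<bullet> indicator_vec B))
      = sum (pmf \<mu>) (bases \<I>) * (w \<bullet> \<eta>) - w \<bullet> \<eta>"
    by (simp add: mean[of w] right_diff_distrib sum_subtractf sum_distrib_right)
  then have "(\<Sum>B\<in>bases \<I>. pmf \<mu> B * (w \<bullet> \<eta> - w \<bullet> indicator_vec B)) = 0"
    by (simp add: total)
  then have "\<forall>B\<in>bases \<I>. pmf \<mu> B * (w \<bullet> \<eta> - w \<bullet> indicator_vec B) = 0"
    by (subst (asm) sum_nonneg_eq_0_iff) (use max in auto)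
  then have slack: "pmf \<mu> B = 0 \<or> w \<bullet> indicator_vec B = w \<bullet> \<eta>" if "B \<in> bases \<I>" for B
    using that by auto
  have "pmf \<mu> B * (c \<bullet> indicator_vec B) \<le> pmf \<mu> B * (c \<bullet> indicator_vec C)"
    if B: "B \<in> bases \<I>" for B
  proof (cases "pmf \<mu> B = 0")
    case False
    then have top: "w \<bullet> indicator_vec B = w \<bullet> \<eta>" using slack[OF B] by blast
    have "c \<bullet> indicator_vec B \<le> c \<bullet> indicator_vec C"
      unfolding inner_indicator_vec
      by (rule max_basis_is_min_basis[OF M B C, of "($) w"])
        (use max top rev in \<open>simp_all flip: inner_indicator_vec\<close>)
    then show ?thesis by (intro mult_left_mono) auto
  qed simp
  then have "c \<bullet> \<eta> \<le> (\<Sum>B\<in>bases \<I>. pmf \<mu> B * (c \<bullet> indicator_vec C))"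
    unfolding mean[of c] by (rule sum_mono)
  then show "c \<bullet> \<eta> \<le> c \<bullet> indicator_vec C" by (simp add: total flip: sum_distrib_right)
qed

section \<open>First-order optimality conditions\<close>

text \<open>
  Moving from \<open>\<eta>\<close> towards \<open>x\<close> keeps all coordinates positive up to, but excluding, \<open>x\<close> itself; a
  positive directional derivative of \<open>\<Sum>e. \<sigma> e * ln (\<eta> e)\<close> would therefore contradict optimality.
\<close>

lemma log_optimal_maximizes_gradient:
  fixes \<sigma> \<eta> :: "real ^ 'e::finite"
  assumes opt: "is_arg_min (\<lambda>\<eta>. - (\<Sum>e\<in>UNIV. \<sigma> $ e * ln (\<eta> $ e)))
       (\<lambda>\<eta>. \<eta> \<in> base_polytope \<I> \<and> (\<forall>e. \<eta> $ e > 0)) \<eta>"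
    and x: "x \<in> base_polytope \<I>"
  shows "(\<chi> e. \<sigma> $ e / \<eta> $ e) \<bullet> x \<le> (\<chi> e. \<sigma> $ e / \<eta> $ e) \<bullet> \<eta>"
proof (rule ccontr)
  assume neg: "\<not> ?thesis"
  have \<eta>: "\<eta> \<in> base_polytope \<I>" "\<And>e. \<eta> $ e > 0"
    using opt by (auto simp: is_arg_min_def)
  define \<phi> where "\<phi> t = (\<Sum>e\<in>UNIV. \<sigma> $ e * ln (\<eta> $ e + t * (x $ e - \<eta> $ e)))" for t :: real
  have "(\<phi> has_real_derivative (\<Sum>e\<in>UNIV. \<sigma> $ e * ((x $ e - \<eta> $ e) / \<eta> $ e))) (at 0)"
    unfolding \<phi>_def using \<eta>(2) by (auto intro!: derivative_eq_intros simp: mult.commute)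
  moreover have "(\<Sum>e\<in>UNIV. \<sigma> $ e * ((x $ e - \<eta> $ e) / \<eta> $ e))
      = (\<chi> e. \<sigma> $ e / \<eta> $ e) \<bullet> x - (\<chi> e. \<sigma> $ e / \<eta> $ e) \<bullet> \<eta>"
    unfolding inner_vec_def sum_subtractf[symmetric]
    by (intro sum.cong) (simp_all add: divide_inverse algebra_simps)
  ultimately have "\<exists>d>0. \<forall>h>0. h < d \<longrightarrow> \<phi> 0 < \<phi> (0 + h)"
    using neg by (intro DERIV_pos_inc_right) auto
  then obtain d where d: "d > 0" "\<And>h. 0 < h \<Longrightarrow> h < d \<Longrightarrow> \<phi> 0 < \<phi> h" by auto
  define t where "t = min (d / 2) (1 / 2)"
  have t: "0 < t" "t < d" "t < 1" using d(1) by (auto simp: t_def)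
  define y where "y = (1 - t) *\<^sub>R \<eta> + t *\<^sub>R x"
  have y_nth: "y $ e = \<eta> $ e + t * (x $ e - \<eta> $ e)" for e
    by (simp add: y_def algebra_simps)
  have "y \<in> base_polytope \<I>"
    unfolding y_def using convexD[OF convex_base_polytope \<eta>(1) x] t by simp
  moreover have "y $ e > 0" for e
    using \<eta>(2)[of e] base_polytope_nonneg[OF x, of e] t
    by (simp add: y_def add_pos_nonneg)
  ultimately have "(\<Sum>e\<in>UNIV. \<sigma> $ e * ln (y $ e)) \<le> (\<Sum>e\<in>UNIV. \<sigma> $ e * ln (\<eta> $ e))"
    using opt by (simp add: is_arg_min_linorder)
  then have "\<phi> t \<le> \<phi> 0" by (simp add: \<phi>_def y_nth)
  then show False using d(2)[OF t(1,2)] by simp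
qed

text \<open>
  The tangent inequality \<open>x\<^sup>2 \<ge> \<eta>\<^sup>2 + 2 * \<eta> * (x - \<eta>)\<close>, weighted and summed: for a convex
  objective the first-order condition suffices.
\<close>

lemma density_energy_mono_of_gradient:
  fixes \<sigma> :: "real ^ 'e::finite"
  assumes pos: "\<And>e. \<sigma> $ e > 0"
    and grad: "(\<chi> e. \<eta> $ e / \<sigma> $ e) \<bullet> \<eta> \<le> (\<chi> e. \<eta> $ e / \<sigma> $ e) \<bullet> x"
  shows "density_energy \<sigma> \<eta> \<le> density_energy \<sigma> x"
proof -
  define c where "c = (\<chi> e. \<eta> $ e / \<sigma> $ e)"
  have "density_energy \<sigma> x - density_energy \<sigma> \<eta> - 2 * (c \<bullet> x - c \<bullet> \<eta>)
      = (\<Sum>e\<in>UNIV. inverse (\<sigma> $ e) * (x $ e - \<eta> $ e)\<^sup>2)"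
    unfolding density_energy_def c_def inner_vec_def sum_subtractf[symmetric] sum_distrib_left
    by (intro sum.cong) (simp_all add: power2_eq_square divide_inverse algebra_simps)
  moreover have "\<dots> \<ge> 0" using pos by (intro sum_nonneg) (simp add: less_imp_le)
  ultimately show ?thesis using grad by (simp flip: c_def)
qed

section \<open>The two densities agree\<close>

theorem theorem4p3:
  fixes \<I> :: "'e::finite set set" and \<sigma> :: "real ^ 'e"
  assumes "matroid (UNIV :: 'e set) \<I>"
    and "loopless (UNIV :: 'e set) \<I>"
    and "matroid_rank \<I> > 0"
    and "\<And>e. \<sigma> $ e > 0"
  shows "MKL_density \<I> \<sigma> = universal_density \<I> \<sigma>"
proof -
  note M = assms(1) and pos = assms(4)
  define \<eta> where "\<eta> = MKL_density \<I> \<sigma>"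
  have "\<exists>\<mu>. MKL_minimizer \<I> \<sigma> (\<eta>, \<mu>)"
    unfolding \<eta>_def MKL_density_def by (rule theI'[OF ex1_MKL[OF M assms(2) pos]])
  then have opt: "is_arg_min (\<lambda>\<eta>. - (\<Sum>e\<in>UNIV. \<sigma> $ e * ln (\<eta> $ e)))
       (\<lambda>\<eta>. \<eta> \<in> base_polytope \<I> \<and> (\<forall>e. \<eta> $ e > 0)) \<eta>"
    by (simp only: MKL_minimizer_iff)
  then have \<eta>: "\<eta> \<in> base_polytope \<I>" "\<And>e. \<eta> $ e > 0" by (auto simp: is_arg_min_def)
  have "density_energy \<sigma> \<eta> \<le> density_energy \<sigma> x" if x: "x \<in> base_polytope \<I>" for x
  proof (rule density_energy_mono_of_gradient[OF pos],
      rule maximizer_is_minimizer[OF M \<eta>(1) x])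
    show "(\<chi> e. \<sigma> $ e / \<eta> $ e) \<bullet> indicator_vec B \<le> (\<chi> e. \<sigma> $ e / \<eta> $ e) \<bullet> \<eta>"
      if "B \<in> bases \<I>" for B
      using that
      by (intro log_optimal_maximizes_gradient[OF opt]) (simp add: base_polytope_def hull_inc)
    show "(\<chi> e. \<sigma> $ e / \<eta> $ e) $ z < (\<chi> e. \<sigma> $ e / \<eta> $ e) $ y"
      if "(\<chi> e. \<eta> $ e / \<sigma> $ e) $ y < (\<chi> e. \<eta> $ e / \<sigma> $ e) $ z" for y z
      using that pos[of y] pos[of z] \<eta>(2)[of y] \<eta>(2)[of z] by (simp add: field_simps)
  qed
  then have "is_arg_min (density_energy \<sigma>) (\<lambda>\<eta>. \<eta> \<in> base_polytope \<I>) \<eta>"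
    using \<eta>(1) by (simp add: is_arg_min_linorder)
  then have "universal_density \<I> \<sigma> = \<eta>"
    unfolding universal_density_def by (rule the1_equality[OF ex1_universal_density[OF M pos]])
  then show ?thesis by (simp add: \<eta>_def)
qed

end
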